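(* Consider the deterministic problem $\min_{x\in\mathbb R^n}\max_{y\in\mathbb R^m}\Phi(x,y)$ with $\Phi(x,y)=\mathcal L(x,y)-h(y)$, where exact gradients $\nabla_x\mathcal L,\nabla_y\mathcal L$ are available, under the standing assumptions (A1)–(A2) of the context. Let $\{x_k,y_k,z_k\}_{k\ge0}$ be generated by the algorithm PDM described in the context, with $\sigma_k=\frac{\mu}{36L_{xy}^2}$, $\alpha_k=\frac{2}{k+2}$, $\lambda_k=\frac{1}{2L_{xx}}$ and any $\gamma_k\in[\lambda_k,(1+\alpha_k/4)\lambda_k]$ for all $k\ge0$, run for $T$ iterations. Then there is a constant $r>0$, independent of $\epsilon$, such that for every $\epsilon>0$ the number $T$ can be chosen so that there exists an iteration $k\in\{0,\dots,T\}$ for which $(z_k,y_k)$ is an $\epsilon$-stationary point, i.e. $$\|\nabla_x\Phi(z_k,y_k)\|\le\epsilon\quad\text{and}\quad\nabla_y\mathcal L(z_k,y_k)\in\partial h(y_k)+\mathcal B(0,r\epsilon),$$ and the total number of gradient evaluations used by the algorithm is $\mathcal O(\epsilon^{-2})$ as $\epsilon\to0$ (with the hidden constant independent of $\epsilon$).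
   Context: **Problem.** $\mathcal L:\mathbb R^n\times\mathbb R^m\to\mathbb R$, $h:\mathbb R^m\to\mathbb R\cup\{+\infty\}$, $\Phi(x,y)=\mathcal L(x,y)-h(y)$. $\|\cdot\|$ is the Euclidean norm, $\partial h$ the convex subdifferential, and $\mathcal B(0,\rho)$ the closed ball of radius $\rho$ centered at $0$. Note $\nabla_x\Phi=\nabla_x\mathcal L$. For $\sigma>0$, $\mathrm{prox}_{\sigma,h}(v)=\operatorname{argmin}_{u\in\mathbb R^m}\{\frac12\|u-v\|^2+\sigma h(u)\}$. **(A1)** The solution set of the min-max problem is nonempty; $h$ is convex and possibly nonsmooth (its proximal map is assumed well defined); $\mathcal L$ is continuously differentiable, $\mathcal L(x,\cdot)$ is concave for every $x$, and $\mathcal L$ satisfies the one-sided Polyak–Łojasiewicz condition: there is $\mu>0$ with $$\tfrac12\|\nabla_x\mathcal L(x,y)\|^2\ge\mu\big(\mathcal L(x,y)-\mathcal L(x^*(y),y)\big)\quad\text{for all }x\in\mathbb R^n,\ y\in\mathbb R^m,$$ where $x^*(y)\in\operatorname{argmin}_x\mathcal L(x,y)$, i.e. $\mathcal L(x^*(y),y)=\min_x\mathcal L(x,y)$. **(A2)** There are constants $L_{xx},L_{xy}>0$ with $\|\nabla_x\mathcal L(x,y)-\nabla_x\mathcal L(\bar x,\bar y)\|\le L_{xx}\|x-\bar x\|+L_{xy}\|y-\bar y\|$ for all $x,\bar x,y,\bar y$. Moreover $\mathcal L(x,y)$ is linear in $y$. **Algorithm PDM.** Given $x_0,\tilde x_0\in\mathbb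 R^n$, $y_0\in\mathbb R^m$, $\alpha_k\in(0,1]$ and positive sequences $\sigma_k,\gamma_k,\lambda_k$, with conventions $x_{-1}=x_0$, $z_0=x_0$, for $k=0,\dots,T-1$ do: 1. $z_{k+1}=(1-\alpha_k)\tilde x_k+\alpha_kx_k$; 2. $p_k=\nabla_y\mathcal L(z_{k+1},y_k)$ and $q_k=\frac{1}{\gamma_k(1-L_{xx}\gamma_k)\mu}\big(\nabla_y\mathcal L(x_k,y_k)-\nabla_y\mathcal L(x_{k-1},y_k)\big)$; 3. $y_{k+1}=\mathrm{prox}_{\sigma_k,h}\big(y_k+\sigma_k(p_k+q_k)\big)$; 4. $r_k=\nabla_x\mathcal L(z_{k+1},y_{k+1})$; 5. $x_{k+1}=x_k-\gamma_kr_k$; 6. $\tilde x_{k+1}=z_{k+1}-\lambda_kr_k$. *)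

theory Defs
  imports "HOL-Analysis.Analysis" "HOL-Library.Landau_Symbols" "HOL-Library.Set_Algebras"
begin

definition grad :: "('a::real_inner \<Rightarrow> real) \<Rightarrow> 'a \<Rightarrow> 'a" where
  "grad f x = (THE D. GDERIV f x :> D)"

definition grad_x :: "('a::real_inner \<Rightarrow> 'b::real_inner \<Rightarrow> real) \<Rightarrow> 'a \<Rightarrow> 'b \<Rightarrow> 'a" where
  "grad_x L x y = grad (\<lambda>u. L u y) x"

definition grad_y :: "('a::real_inner \<Rightarrow> 'b::real_inner \<Rightarrow> real) \<Rightarrow> 'a \<Rightarrow> 'b \<Rightarrow> 'b" where
  "grad_y L x y = grad (L x) y"

definition continuously_differentiable :: "('a::real_inner \<Rightarrow> real) \<Rightarrow> bool" where
  "continuously_differentiable f \<longleftrightarrow>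
     (\<forall>x. f differentiable (at x)) \<and> continuous_on UNIV (grad f)"

text \<open>
  "Linear in y" is read, as usual for Lagrangians such as f(x) + (A x + b) \<bullet> y, as affine
  in y. Homogeneity in y together with the Polyak--Lojasiewicz condition for all y would force
  L to be constant in x (scale y by t > 0 and let t tend to 0).
\<close>
definition affine_map :: "('a::real_vector \<Rightarrow> real) \<Rightarrow> bool" where
  "affine_map f \<longleftrightarrow> linear (\<lambda>y. f y - f 0)"

definition one_sided_PL :: "('a::real_inner \<Rightarrow> 'b::real_inner \<Rightarrow> real) \<Rightarrow> real \<Rightarrow> bool" where
  "one_sided_PL L \<mu> \<longleftrightarrow>
     (\<forall>y. \<exists>xs. is_arg_min (\<lambda>x. L x y) (\<lambda>_. True) xs \<and>
        (\<forall>x. (norm (grad_x L x y))\<^sup>2 / 2 \<ge> \<mu> * (L x y - L xs y)))"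

text \<open>
  A function h with values in the reals extended by plus infinity is an \<^typ>\<open>ereal\<close>-valued
  function that never takes the value minus infinity.
\<close>
definition convex_ext :: "('b::real_vector \<Rightarrow> ereal) \<Rightarrow> bool" where
  "convex_ext h \<longleftrightarrow> (\<forall>y. h y \<noteq> - \<infinity>) \<and>
     (\<forall>u v. \<forall>t\<in>{0<..<1::real}.
        h ((1 - t) *\<^sub>R u + t *\<^sub>R v) \<le> ereal (1 - t) * h u + ereal t * h v)"

definition subdifferential :: "('b::real_inner \<Rightarrow> ereal) \<Rightarrow> 'b \<Rightarrow> 'b set" where
  "subdifferential h y = {g. \<bar>h y\<bar> \<noteq> \<infinity> \<and> (\<forall>w. h y + ereal (g \<bullet> (w - y)) \<le> h w)}"

definition prox_objective :: "real \<Rightarrow> ('b::real_inner \<Rightarrow> ereal) \<Rightarrow> 'b \<Rightarrow> 'b \<Rightarrow> ereal" where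
  "prox_objective \<sigma> h v u = ereal ((norm (u - v))\<^sup>2 / 2) + ereal \<sigma> * h u"

definition prox :: "real \<Rightarrow> ('b::real_inner \<Rightarrow> ereal) \<Rightarrow> 'b \<Rightarrow> 'b" where
  "prox \<sigma> h v = arg_min (prox_objective \<sigma> h v) (\<lambda>_. True)"

definition prox_well_defined :: "('b::real_inner \<Rightarrow> ereal) \<Rightarrow> bool" where
  "prox_well_defined h \<longleftrightarrow>
     (\<forall>\<sigma>>0. \<forall>v. \<exists>!u. is_arg_min (prox_objective \<sigma> h v) (\<lambda>_. True) u)"

definition Phi :: "('a \<Rightarrow> 'b \<Rightarrow> real) \<Rightarrow> ('b \<Rightarrow> ereal) \<Rightarrow> 'a \<Rightarrow> 'b \<Rightarrow> ereal" where
  "Phi L h x y = ereal (L x y) - h y"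

text \<open>
  A solution of the min-max problem is a saddle point: a pair optimal both for the min-max and
  for the max-min problem, with equal values.
\<close>
definition minmax_solutions :: "('a \<Rightarrow> 'b \<Rightarrow> real) \<Rightarrow> ('b \<Rightarrow> ereal) \<Rightarrow> ('a \<times> 'b) set" where
  "minmax_solutions L h = {(xs, ys). \<forall>x y.
     Phi L h xs y \<le> Phi L h xs ys \<and> Phi L h xs ys \<le> Phi L h x ys}"

text \<open>
  The sequence xt is the auxiliary sequence written x with a tilde. The convention that the
  iterate with index -1 equals x 0 is provided by truncated subtraction on the naturals:
  x (0 - 1) = x 0.
\<close>
definition PDM ::
  "('a::real_inner \<Rightarrow> 'b::real_inner \<Rightarrow> real) \<Rightarrow> ('b \<Rightarrow> ereal) \<Rightarrow> real \<Rightarrow> real \<Rightarrow>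
   (nat \<Rightarrow> real) \<Rightarrow> (nat \<Rightarrow> real) \<Rightarrow> (nat \<Rightarrow> real) \<Rightarrow> (nat \<Rightarrow> real) \<Rightarrow>
   (nat \<Rightarrow> 'a) \<Rightarrow> (nat \<Rightarrow> 'a) \<Rightarrow> (nat \<Rightarrow> 'b) \<Rightarrow> (nat \<Rightarrow> 'a) \<Rightarrow> bool" where
  "PDM L h L\<^sub>x\<^sub>x \<mu> \<alpha> \<sigma> \<gamma> lam x xt y z \<longleftrightarrow>
     z 0 = x 0 \<and>
     (\<forall>k. z (k + 1) = (1 - \<alpha> k) *\<^sub>R xt k + \<alpha> k *\<^sub>R x k \<and>
       (let p = grad_y L (z (k + 1)) (y k);
            q = (1 / (\<gamma> k * (1 - L\<^sub>x\<^sub>x * \<gamma> k) * \<mu>)) *\<^sub>R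
                  (grad_y L (x k) (y k) - grad_y L (x (k - 1)) (y k));
            r = grad_x L (z (k + 1)) (y (k + 1))
        in y (k + 1) = prox (\<sigma> k) h (y k + \<sigma> k *\<^sub>R (p + q)) \<and>
           x (k + 1) = x k - \<gamma> k *\<^sub>R r \<and>
           xt (k + 1) = z (k + 1) - lam k *\<^sub>R r))"

text \<open>
  The points at which iteration k of PDM evaluates a partial gradient: one evaluation for p,
  two for q and one for r.
\<close>
datatype ('a, 'b) gradient_query = Query_x 'a 'b | Query_y 'a 'b

definition PDM_queries ::
  "(nat \<Rightarrow> 'a) \<Rightarrow> (nat \<Rightarrow> 'b) \<Rightarrow> (nat \<Rightarrow> 'a) \<Rightarrow> nat \<Rightarrow> ('a, 'b) gradient_query list" where
  "PDM_queries x y z k =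
     [Query_y (z (k + 1)) (y k), Query_y (x k) (y k), Query_y (x (k - 1)) (y k),
      Query_x (z (k + 1)) (y (k + 1))]"

definition gradient_evaluations ::
  "(nat \<Rightarrow> 'a) \<Rightarrow> (nat \<Rightarrow> 'b) \<Rightarrow> (nat \<Rightarrow> 'a) \<Rightarrow> nat \<Rightarrow> nat" where
  "gradient_evaluations x y z T = (\<Sum>k<T. length (PDM_queries x y z k))"

text \<open>
  The x-gradient of \<^const>\<open>Phi\<close> is that of L, since h does not depend on x. The sum in the
  second condition is the Minkowski sum of sets.
\<close>
definition eps_stationary ::
  "('a::real_inner \<Rightarrow> 'b::real_inner \<Rightarrow> real) \<Rightarrow> ('b \<Rightarrow> ereal) \<Rightarrow> real \<Rightarrow> real \<Rightarrow> 'a \<Rightarrow> 'b \<Rightarrow> bool"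
where
  "eps_stationary L h r \<epsilon> x y \<longleftrightarrow>
     norm (grad_x L x y) \<le> \<epsilon> \<and>
     grad_y L x y \<in> subdifferential h y + cball 0 (r * \<epsilon>)"

end

theory Submission
  imports Defs
begin

text \<open>
  Since \<open>L\<close> is affine in its second argument, \<open>L u v = L u 0 + A u \<bullet> v\<close>, where \<open>A u\<close> is the
  gradient in that argument; the Lipschitz condition on the gradient in \<open>u\<close> makes \<open>A\<close>
  Lipschitz with constant \<open>L\<^sub>x\<^sub>y\<close>. Fix a saddle point \<open>(xs, ys)\<close>.

  The proximal step, compared with \<open>ys\<close> (\<open>dual_step\<close>), has two contributions besides the
  telescoping distances \<open>\<parallel>y\<^sub>k - ys\<parallel>\<^sup>2\<close>. The one of \<open>A (z\<^sub>k\<^sub>+\<^sub>1)\<close> is the gap between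
  \<open>\<Phi> z\<^sub>k\<^sub>+\<^sub>1 y\<^sub>k\<^sub>+\<^sub>1\<close> and \<open>\<Phi> z\<^sub>k\<^sub>+\<^sub>1 ys\<close>. By the saddle property it is at most the primal
  suboptimality of \<open>z\<^sub>k\<^sub>+\<^sub>1\<close> at \<open>y\<^sub>k\<^sub>+\<^sub>1\<close>, hence at most \<open>\<parallel>r\<^sub>k\<parallel>\<^sup>2 / (2 \<mu>)\<close> by the
  Polyak--Lojasiewicz condition (\<open>PL_saddle_gap\<close>).

  The contribution of the extrapolation term pays for this. By affinity,
  \<open>(A x\<^sub>k\<^sub>+\<^sub>1 - A x\<^sub>k) \<bullet> (y\<^sub>k\<^sub>+\<^sub>1 - ys)\<close> is a difference of values of \<open>L\<close>: it equals minus the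
  decrease of \<open>L \<sqdot> y\<^sub>k\<^sub>+\<^sub>1\<close> from \<open>x\<^sub>k\<close> to \<open>x\<^sub>k\<^sub>+\<^sub>1\<close>, plus the decrease of
  \<open>E\<^sub>k = L x\<^sub>k ys - L xs ys \<ge> 0\<close>, which telescopes (\<open>A_step_inner_saddle\<close>). The weight
  \<open>1 / (\<gamma>\<^sub>k (1 - L\<^sub>x\<^sub>x \<gamma>\<^sub>k) \<mu>)\<close> of that term is large enough for the decrease to exceed the gap
  above. The remaining product of \<open>A x\<^sub>k\<^sub>+\<^sub>1 - A x\<^sub>k\<close> with \<open>y\<^sub>k\<^sub>+\<^sub>2 - y\<^sub>k\<^sub>+\<^sub>1\<close> is absorbed by
  Young's inequality, which the value of \<open>\<sigma>\<^sub>k\<close> permits.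

  The decrease of \<open>L \<sqdot> y\<^sub>k\<^sub>+\<^sub>1\<close> is the usual one for a gradient step (\<open>D_lower\<close>), up to
  an error caused by evaluating the gradient at \<open>z\<^sub>k\<^sub>+\<^sub>1\<close>. This error is governed by the
  distance of the two primal sequences, whose squares sum up to at most a constant plus a
  multiple of \<open>\<Sum>\<parallel>r\<^sub>k\<parallel>\<^sup>2\<close>
  (\<open>N_Suc\<close>). The weights of the extrapolation term vary with \<open>k\<close>, so that telescoping
  needs decreasing factors \<open>w\<^sub>k\<close> (\<open>w_C_Suc\<close>).

  Altogether a nonnegative Lyapunov function \<open>P\<close> decreases at each step by at least
  \<open>2 L\<^sub>x\<^sub>y\<^sup>2 \<parallel>y\<^sub>k\<^sub>+\<^sub>2 - y\<^sub>k\<^sub>+\<^sub>1\<parallel>\<^sup>2 + \<parallel>r\<^sub>k\<parallel>\<^sup>2 / 4\<close> (\<open>P_Suc\<close>). Hence one of the first \<open>n\<close>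
  steps has a decrease of order \<open>1 / n\<close>, and a small decrease in two consecutive steps yields
  stationarity (\<open>stationary_step\<close>): the distance of \<open>A (z\<^sub>k\<^sub>+\<^sub>1)\<close> to the subgradient of
  \<open>h\<close> provided by the proximal step is bounded by \<open>\<parallel>y\<^sub>k\<^sub>+\<^sub>1 - y\<^sub>k\<parallel> / \<sigma>\<^sub>k\<close> plus a
  constant multiple of \<open>\<parallel>r\<^sub>k\<^sub>-\<^sub>1\<parallel>\<close>.
\<close>

section \<open>Gradients\<close>

lemma GDERIV_unique:
  assumes "GDERIV f x :> D" "GDERIV f x :> D'"
  shows "D = D'"
proof -
  have "(\<lambda>h. h \<bullet> D) = (\<lambda>h. h \<bullet> D')"
    using assms unfolding gderiv_def by (rule has_derivative_unique)
  then have "(D - D') \<bullet> (D - D') = 0"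
    by (metis inner_diff_right diff_self)
  then show ?thesis by simp
qed

lemma grad_eqI: "GDERIV f x :> D \<Longrightarrow> grad f x = D"
  unfolding grad_def by (blast intro: the_equality GDERIV_unique)

lemma linear_functional_inner:
  fixes f :: "'a::euclidean_space \<Rightarrow> real"
  assumes "linear f"
  shows "f v = v \<bullet> (\<Sum>b\<in>Basis. f b *\<^sub>R b)"
proof -
  have "f v = f (\<Sum>b\<in>Basis. (v \<bullet> b) *\<^sub>R b)" by (simp add: euclidean_representation)
  also have "\<dots> = (\<Sum>b\<in>Basis. (v \<bullet> b) * f b)"
    using assms by (simp add: linear_sum linear_scale)
  also have "\<dots> = v \<bullet> (\<Sum>b\<in>Basis. f b *\<^sub>R b)"
    by (simp add: inner_sum_right mult.commute)
  finally show ?thesis .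
qed

lemma GDERIV_grad:
  fixes f :: "'a::euclidean_space \<Rightarrow> real"
  assumes "f differentiable (at x)"
  shows "GDERIV f x :> grad f x"
proof -
  obtain f' where f': "(f has_derivative f') (at x)"
    using assms by (auto simp: differentiable_def)
  have "f' = (\<lambda>k. k \<bullet> (\<Sum>b\<in>Basis. f' b *\<^sub>R b))"
    using linear_functional_inner[OF has_derivative_linear[OF f']] by (rule ext)
  with f' have "GDERIV f x :> (\<Sum>b\<in>Basis. f' b *\<^sub>R b)"
    unfolding gderiv_def by simp
  then show ?thesis using grad_eqI by metis
qed

text \<open>The quadratic upper bound for a function with Lipschitz gradient.\<close>

lemma descent_lemma:
  fixes f :: "'a::real_inner \<Rightarrow> real"
  assumes der: "\<And>u. GDERIV f u :> g u"
    and lip: "\<And>u v. norm (g u - g v) \<le> M * norm (u - v)"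
  shows "f (u + d) \<le> f u + g u \<bullet> d + M / 2 * (norm d)\<^sup>2"
proof -
  define \<phi> where "\<phi> t = f (u + t *\<^sub>R d) - t * (g u \<bullet> d) - M / 2 * t\<^sup>2 * (norm d)\<^sup>2" for t :: real
  have d: "(\<phi> has_real_derivative (g (u + t *\<^sub>R d) \<bullet> d - g u \<bullet> d - M * t * (norm d)\<^sup>2)) (at t)" for t
  proof -
    have "((\<lambda>t. u + t *\<^sub>R d) has_derivative (\<lambda>h. h *\<^sub>R d)) (at t)"
      by (auto intro!: derivative_eq_intros)
    from has_derivative_compose[OF this, of f "\<lambda>h. h \<bullet> g (u + t *\<^sub>R d)"]
    have "((\<lambda>t. f (u + t *\<^sub>R d)) has_derivative (\<lambda>h. (h *\<^sub>R d) \<bullet> g (u + t *\<^sub>R d))) (at t)"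
      using der[of "u + t *\<^sub>R d"] by (simp add: gderiv_def)
    then have "((\<lambda>t. f (u + t *\<^sub>R d)) has_real_derivative g (u + t *\<^sub>R d) \<bullet> d) (at t)"
      by (simp add: has_field_derivative_def inner_commute mult.commute[of _ "_ \<bullet> _"])
    then show ?thesis unfolding \<phi>_def
      by (auto intro!: derivative_eq_intros)
  qed
  have "\<phi> 1 \<le> \<phi> 0"
  proof (rule DERIV_nonpos_imp_nonincreasing[where f = \<phi>])
    fix t :: real assume t: "0 \<le> t" "t \<le> 1"
    have "(g (u + t *\<^sub>R d) - g u) \<bullet> d \<le> norm (g (u + t *\<^sub>R d) - g u) * norm d"
      by (rule norm_cauchy_schwarz)
    also have "\<dots> \<le> (M * norm (t *\<^sub>R d)) * norm d"
      using lip[of "u + t *\<^sub>R d" u] by (intro mult_right_mono) auto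
    also have "\<dots> = M * t * (norm d)\<^sup>2" using t by (simp add: power2_eq_square)
    finally have "g (u + t *\<^sub>R d) \<bullet> d - g u \<bullet> d - M * t * (norm d)\<^sup>2 \<le> 0"
      by (simp add: inner_diff_left)
    then show "\<exists>y. (\<phi> has_real_derivative y) (at t) \<and> y \<le> 0" using d by blast
  qed simp
  then show ?thesis by (simp add: \<phi>_def)
qed

lemma GDERIV_lipschitz:
  fixes f :: "'a::real_inner \<Rightarrow> real"
  assumes der: "\<And>u. GDERIV f u :> g u" and bnd: "\<And>u. norm (g u) \<le> M"
  shows "\<bar>f u - f v\<bar> \<le> M * norm (u - v)"
proof -
  have "norm (f u - f v) \<le> M * norm (u - v)"
  proof (rule differentiable_bound[of UNIV f "\<lambda>w k. k \<bullet> g w"])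
    show "onorm (\<lambda>k. k \<bullet> g w) \<le> M" for w
    proof (rule onorm_bound)
      show "0 \<le> M" using norm_ge_zero bnd order_trans by blast
      fix k
      have "\<bar>k \<bullet> g w\<bar> \<le> norm k * norm (g w)" by (rule Cauchy_Schwarz_ineq2)
      also have "\<dots> \<le> M * norm k" using bnd[of w] by (subst mult.commute) (simp add: mult_right_mono)
      finally show "norm (k \<bullet> g w) \<le> M * norm k" by simp
    qed
  qed (use der in \<open>auto simp: gderiv_def\<close>)
  then show ?thesis by simp
qed

section \<open>The proximal map\<close>

lemma norm_add_scaleR_sq:
  fixes p q :: "'a::real_inner"
  shows "(norm (p + t *\<^sub>R q))\<^sup>2 = (norm p)\<^sup>2 + 2 * t * (p \<bullet> q) + t\<^sup>2 * (norm q)\<^sup>2"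
  unfolding power2_norm_eq_inner
  by (simp add: inner_add_left inner_add_right inner_commute power2_eq_square)


text \<open>If \<open>h\<close> were infinite everywhere, every point would minimize the proximal objective, against
  uniqueness of the minimizer.\<close>

lemma prox_well_defined_finite:
  assumes pw: "prox_well_defined (h :: 'b::euclidean_space \<Rightarrow> ereal)"
  shows "\<exists>w. h w \<noteq> \<infinity>"
proof (rule ccontr)
  assume "\<not> ?thesis"
  then have "\<And>w. prox_objective 1 h 0 w = \<infinity>" by (simp add: prox_objective_def)
  then have "\<And>u. is_arg_min (prox_objective 1 h 0) (\<lambda>_. True) u"
    by (simp add: is_arg_min_def)
  moreover obtain b :: 'b where "b \<in> Basis" using nonempty_Basis by blast
  then have "b \<noteq> 0" by auto
  ultimately show False using pw[unfolded prox_well_defined_def, rule_format, of 1 0]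
    by (metis zero_less_one)
qed

text \<open>The optimality condition of the proximal step. For convex \<open>h\<close>, moving from the minimizer
  \<open>u\<close> a fraction \<open>t\<close> of the way to \<open>w\<close> and letting \<open>t\<close> tend to 0 gives the subgradient
  inequality at \<open>w\<close>.\<close>

lemma prox_subgradient:
  fixes h :: "'b::euclidean_space \<Rightarrow> ereal" and v :: 'b
  assumes cv: "convex_ext h" and pw: "prox_well_defined h" and s: "s > 0"
  defines "u \<equiv> prox s h v"
  shows "(1 / s) *\<^sub>R (v - u) \<in> subdifferential h u"
proof -
  obtain w0 where w0: "h w0 \<noteq> \<infinity>" using prox_well_defined_finite[OF pw] by blast
  have hm: "h w \<noteq> -\<infinity>" for w using cv by (auto simp: convex_ext_def)
  have min: "prox_objective s h v u \<le> prox_objective s h v w" for w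
  proof -
    have "\<exists>!u. is_arg_min (prox_objective s h v) (\<lambda>_. True) u"
      using pw s by (auto simp: prox_well_defined_def)
    then have "is_arg_min (prox_objective s h v) (\<lambda>_. True) u"
      unfolding u_def prox_def arg_min_def by (metis (mono_tags, lifting) someI_ex)
    then show ?thesis by (auto simp: is_arg_min_def not_less)
  qed
  have hu: "\<bar>h u\<bar> \<noteq> \<infinity>"
    using min[of w0] w0 hm[of u] hm[of w0] s
    by (cases "h u"; cases "h w0") (auto simp: prox_objective_def)
  have "h u + ereal (((1 / s) *\<^sub>R (v - u)) \<bullet> (w - u)) \<le> h w" for w
  proof (cases "h w = \<infinity>")
    case False
    obtain a where a: "h u = ereal a" using hu by (cases "h u") auto
    obtain b where b: "h w = ereal b" using False hm[of w] by (cases "h w") auto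
    have ineq: "(v - u) \<bullet> (w - u) \<le> s * (b - a) + t / 2 * (norm (w - u))\<^sup>2"
      if t: "0 < t" "t < 1" for t
    proof -
      let ?m = "(1 - t) *\<^sub>R u + t *\<^sub>R w"
      have m: "h ?m \<le> ereal ((1 - t) * a + t * b)"
      proof -
        have "h ?m \<le> ereal (1 - t) * h u + ereal t * h w"
          using cv t by (simp add: convex_ext_def)
        then show ?thesis by (simp add: a b)
      qed
      obtain c where c: "h ?m = ereal c" using m hm[of ?m] by (cases "h ?m") auto
      have 1: "(norm (u - v))\<^sup>2 / 2 + s * a \<le> (norm (?m - v))\<^sup>2 / 2 + s * c"
        using min[of ?m] a c by (simp add: prox_objective_def)
      have 2: "s * c \<le> s * ((1 - t) * a + t * b)"
        using m c s by simp
      have "?m - v = (u - v) + t *\<^sub>R (w - u)" by (simp add: algebra_simps)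
      then have "(norm (?m - v))\<^sup>2 =
          (norm (u - v))\<^sup>2 + 2 * t * ((u - v) \<bullet> (w - u)) + t\<^sup>2 * (norm (w - u))\<^sup>2"
        by (simp only: norm_add_scaleR_sq)
      moreover have "(u - v) \<bullet> (w - u) = - ((v - u) \<bullet> (w - u))"
        by (simp add: inner_diff_left)
      ultimately have 3: "(norm (?m - v))\<^sup>2 =
          (norm (u - v))\<^sup>2 - 2 * t * ((v - u) \<bullet> (w - u)) + t\<^sup>2 * (norm (w - u))\<^sup>2"
        by simp
      have "t * ((v - u) \<bullet> (w - u)) \<le> t * (s * (b - a) + t / 2 * (norm (w - u))\<^sup>2)"
        using 1 2 3 by (simp add: algebra_simps power2_eq_square)
      then show ?thesis using t by simp
    qed
    have "((\<lambda>t. s * (b - a) + t / 2 * (norm (w - u))\<^sup>2) \<longlongrightarrow> s * (b - a) + 0 / 2 * (norm (w - u))\<^sup>2) (at_right 0)"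
      by (intro tendsto_intros) simp_all
    moreover have "\<forall>\<^sub>F t in at_right 0. (v - u) \<bullet> (w - u) \<le> s * (b - a) + t / 2 * (norm (w - u))\<^sup>2"
      by (rule eventually_at_rightI[of 0 1]) (use ineq in auto)
    ultimately have "(v - u) \<bullet> (w - u) \<le> s * (b - a) + 0 / 2 * (norm (w - u))\<^sup>2"
      by (intro tendsto_lowerbound) auto
    then have "((v - u) \<bullet> (w - u)) / s \<le> b - a" using s by (simp add: field_simps)
    then show ?thesis by (simp add: a b)
  qed simp
  then show ?thesis using hu by (simp add: subdifferential_def)
qed


section \<open>Runs of the primal-dual method\<close>

text \<open>A run of the method with the prescribed step sizes, for arbitrary Euclidean spaces.\<close>

locale pdm_run =
  fixes L :: "'a::euclidean_space \<Rightarrow> 'b::euclidean_space \<Rightarrow> real"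
    and h :: "'b \<Rightarrow> ereal"
    and \<mu> L\<^sub>x\<^sub>x L\<^sub>x\<^sub>y :: real
    and \<alpha> \<sigma> \<gamma> lam :: "nat \<Rightarrow> real"
    and x xt z :: "nat \<Rightarrow> 'a"
    and y :: "nat \<Rightarrow> 'b"
  assumes solvable: "minmax_solutions L h \<noteq> {}"
    and h_convex: "convex_ext h"
    and h_prox: "prox_well_defined h"
    and L_C1: "continuously_differentiable (\<lambda>(u, v). L u v)"
    and mu_pos: "\<mu> > 0"
    and L_PL: "one_sided_PL L \<mu>"
    and Lip_pos: "L\<^sub>x\<^sub>x > 0" "L\<^sub>x\<^sub>y > 0"
    and L_Lip: "\<And>u u' v v'. norm (grad_x L u v - grad_x L u' v')
                  \<le> L\<^sub>x\<^sub>x * norm (u - u') + L\<^sub>x\<^sub>y * norm (v - v')"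
    and L_affine: "\<And>u. affine_map (L u)"
    and sigma: "\<And>k. \<sigma> k = \<mu> / (36 * L\<^sub>x\<^sub>y\<^sup>2)"
    and alpha: "\<And>k. \<alpha> k = 2 / (real k + 2)"
    and lambda: "\<And>k. lam k = 1 / (2 * L\<^sub>x\<^sub>x)"
    and gamma: "\<And>k. \<gamma> k \<in> {lam k .. (1 + \<alpha> k / 4) * lam k}"
    and run: "PDM L h L\<^sub>x\<^sub>x \<mu> \<alpha> \<sigma> \<gamma> lam x xt y z"
begin

subsection \<open>The coupling function\<close>

text \<open>The gradient in the second argument, which is constant there: \<open>L u v = L u 0 + A u \<bullet> v\<close>.\<close>

definition A :: "'a \<Rightarrow> 'b" where
  "A u = grad_y L u 0"

lemma GDERIV_x: "GDERIV (\<lambda>w. L w v) u :> grad_x L u v"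
proof -
  have "(\<lambda>(u, v). L u v) differentiable (at (u, v))"
    using L_C1 by (simp add: continuously_differentiable_def)
  then obtain L' where "((\<lambda>(u, v). L u v) has_derivative L') (at (u, v))"
    by (auto simp: differentiable_def)
  moreover have "((\<lambda>w. (w, v)) has_derivative (\<lambda>k. (k, 0))) (at u)"
    by (auto intro!: derivative_eq_intros)
  ultimately have "((\<lambda>w. L w v) has_derivative (\<lambda>k. L' (k, 0))) (at u)"
    using has_derivative_compose[of "\<lambda>w. (w, v)" _ u UNIV "\<lambda>(u, v). L u v" L'] by simp
  then show ?thesis
    unfolding grad_x_def by (intro GDERIV_grad) (auto simp: differentiable_def)
qed

lemma GDERIV_y_affine:
  obtains a where "\<And>v. L u v = L u 0 + a \<bullet> v" "\<And>v. GDERIV (L u) v :> a"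
proof -
  have lin: "linear (\<lambda>v. L u v - L u 0)" using L_affine by (simp add: affine_map_def)
  define a where "a = (\<Sum>b\<in>Basis. (L u b - L u 0) *\<^sub>R b)"
  have eq: "L u v = L u 0 + a \<bullet> v" for v
    using linear_functional_inner[OF lin, of v] by (simp add: a_def inner_commute)
  have "L u = (\<lambda>v. L u 0 + a \<bullet> v)" using eq by (rule ext)
  moreover have "GDERIV (\<lambda>v. L u 0 + a \<bullet> v) v :> a" for v
    unfolding gderiv_def by (auto intro!: derivative_eq_intros simp: inner_commute)
  ultimately have "GDERIV (L u) v :> a" for v by simp
  with eq show ?thesis using that by blast
qed

lemma grad_y_eq: "grad_y L u v = A u"
  by (metis A_def GDERIV_y_affine grad_eqI grad_y_def)

lemma L_diff_y: "L u v - L u w = A u \<bullet> (v - w)"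
proof -
  obtain a where a: "\<And>v. L u v = L u 0 + a \<bullet> v" "\<And>v. GDERIV (L u) v :> a"
    using GDERIV_y_affine by blast
  have "A u = a" unfolding A_def grad_y_def using a(2) by (rule grad_eqI)
  then show ?thesis using a(1)[of v] a(1)[of w] by (simp add: inner_diff_right)
qed

text \<open>For fixed \<open>v\<close>, the function \<open>A u \<bullet> v = L u v - L u 0\<close> of \<open>u\<close> has gradient of norm at most
  \<open>L\<^sub>x\<^sub>y * norm v\<close>; take for \<open>v\<close> the difference of the two values of \<open>A\<close>.\<close>

lemma A_lipschitz: "norm (A u - A w) \<le> L\<^sub>x\<^sub>y * norm (u - w)"
proof -
  let ?d = "A u - A w"
  have eq: "A u' \<bullet> ?d = L u' ?d - L u' 0" for u' by (simp add: L_diff_y)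
  have der: "GDERIV (\<lambda>u'. A u' \<bullet> ?d) u' :> grad_x L u' ?d - grad_x L u' 0" for u'
    unfolding eq by (intro GDERIV_diff GDERIV_x)
  have "norm (grad_x L u' ?d - grad_x L u' 0) \<le> L\<^sub>x\<^sub>y * norm ?d" for u'
    using L_Lip[of u' ?d u' 0] by simp
  from GDERIV_lipschitz[OF der this, of u w]
  have "norm ?d * norm ?d \<le> (L\<^sub>x\<^sub>y * norm (u - w)) * norm ?d"
    by (simp add: inner_diff_left[symmetric] dot_square_norm power2_eq_square mult_ac)
  moreover have "0 \<le> L\<^sub>x\<^sub>y * norm (u - w)" using Lip_pos by simp
  ultimately show ?thesis by (cases "norm ?d = 0") auto
qed

lemma descent_x: "L (u + d) v \<le> L u v + grad_x L u v \<bullet> d + L\<^sub>x\<^sub>x / 2 * (norm d)\<^sup>2"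
  by (rule descent_lemma[where f = "\<lambda>w. L w v", OF GDERIV_x]) (use L_Lip[of _ v _ v] in simp)

subsection \<open>The saddle point\<close>

lemma h_not_minf: "h v \<noteq> -\<infinity>"
  using h_convex by (auto simp: convex_ext_def)

text \<open>A saddle point at which \<open>h\<close> is finite, so that its defining inequalities can be read in
  the reals; the second one is only needed where \<open>h\<close> is finite.\<close>

definition finite_saddle :: "'a \<Rightarrow> 'b \<Rightarrow> bool" where
  "finite_saddle u v \<longleftrightarrow> \<bar>h v\<bar> \<noteq> \<infinity> \<and> (\<forall>u'. L u v \<le> L u' v) \<and>
     (\<forall>v'. \<bar>h v'\<bar> \<noteq> \<infinity> \<longrightarrow>
        L u v' - real_of_ereal (h v') \<le> L u v - real_of_ereal (h v))"

lemma finite_saddle_exists: "\<exists>u v. finite_saddle u v"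
proof -
  obtain u v where s: "\<And>u' v'. Phi L h u v' \<le> Phi L h u v \<and> Phi L h u v \<le> Phi L h u' v"
    using solvable by (auto simp: minmax_solutions_def)
  obtain v0 where "h v0 \<noteq> \<infinity>" using prox_well_defined_finite[OF h_prox] by blast
  with h_not_minf[of v0] obtain a where a: "h v0 = ereal a" by (cases "h v0") auto
  \<comment> \<open>If \<open>h v\<close> were infinite, maximality of \<open>v\<close> would make \<open>h\<close> infinite everywhere.\<close>
  have "h v \<noteq> \<infinity>" using s[of v0 u] a by (auto simp: Phi_def)
  with h_not_minf[of v] obtain b where b: "h v = ereal b" by (cases "h v") auto
  have "finite_saddle u v"
    unfolding finite_saddle_def
  proof (intro conjI allI impI)
    show "\<bar>h v\<bar> \<noteq> \<infinity>" by (simp add: b)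
    show "L u v \<le> L u' v" for u' using s[of v u'] by (simp add: Phi_def b)
    show "L u v' - real_of_ereal (h v') \<le> L u v - real_of_ereal (h v)"
      if "\<bar>h v'\<bar> \<noteq> \<infinity>" for v'
      using s[of v' u] that b by (cases "h v'") (auto simp: Phi_def)
  qed
  then show ?thesis by blast
qed

text \<open>A fixed choice of such a saddle point.\<close>

definition xs :: 'a where "xs = (SOME u. \<exists>v. finite_saddle u v)"
definition ys :: 'b where "ys = (SOME v. finite_saddle xs v)"

lemma finite_saddle_xs_ys: "finite_saddle xs ys"
proof -
  have "\<exists>v. finite_saddle xs v"
    unfolding xs_def by (rule someI_ex) (rule finite_saddle_exists)
  then show ?thesis unfolding ys_def by (rule someI_ex)
qed

lemma h_ys: "\<bar>h ys\<bar> \<noteq> \<infinity>"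
  and saddle_x: "L xs ys \<le> L u ys"
  and saddle_y: "\<bar>h v\<bar> \<noteq> \<infinity> \<Longrightarrow>
    L xs v - real_of_ereal (h v) \<le> L xs ys - real_of_ereal (h ys)"
  using finite_saddle_xs_ys by (simp_all add: finite_saddle_def)

text \<open>The gap of \<open>\<Phi> u\<close> between \<open>v\<close> and \<open>ys\<close> is bounded by the suboptimality of \<open>u\<close> for \<open>L \<sqdot> v\<close>:
  \<open>\<Phi> u ys \<ge> \<Phi> xs ys \<ge> \<Phi> xs v \<ge> min (\<Phi> \<sqdot> v)\<close>.\<close>

lemma PL_saddle_gap:
  assumes "\<bar>h v\<bar> \<noteq> \<infinity>"
  shows "\<mu> * ((L u v - real_of_ereal (h v)) - (L u ys - real_of_ereal (h ys)))
    \<le> (norm (grad_x L u v))\<^sup>2 / 2"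
proof -
  obtain w where w: "is_arg_min (\<lambda>u. L u v) (\<lambda>_. True) w"
    "\<mu> * (L u v - L w v) \<le> (norm (grad_x L u v))\<^sup>2 / 2"
    using L_PL by (auto simp: one_sided_PL_def)
  have "L w v \<le> L xs v" using w(1) by (auto simp: is_arg_min_def not_less)
  then have "(L u v - real_of_ereal (h v)) - (L u ys - real_of_ereal (h ys)) \<le> L u v - L w v"
    using saddle_x[of u] saddle_y[OF assms] by simp
  then have "\<mu> * ((L u v - real_of_ereal (h v)) - (L u ys - real_of_ereal (h ys)))
    \<le> \<mu> * (L u v - L w v)" using mu_pos by simp
  with w(2) show ?thesis by linarith
qed

subsection \<open>Step sizes\<close>

text \<open>The factor of the extrapolation term, multiplied by \<open>\<mu>\<close>.\<close>

definition C :: "nat \<Rightarrow> real" where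
  "C k = 1 / (\<gamma> k * (1 - L\<^sub>x\<^sub>x * \<gamma> k))"

text \<open>Weights decreasing to 1, just fast enough to compensate a possible growth of \<open>C\<close>.\<close>

definition w :: "nat \<Rightarrow> real" where
  "w k = (real k + 4) / (real k + 3)"

lemma sigma_pos: "\<sigma> k > 0"
  using mu_pos Lip_pos by (simp add: sigma)

lemma gamma_lower: "1 / 2 \<le> L\<^sub>x\<^sub>x * \<gamma> k"
  and gamma_upper: "L\<^sub>x\<^sub>x * \<gamma> k \<le> 1 / 2 + 1 / (4 * (real k + 2))"
proof -
  have g: "1 / (2 * L\<^sub>x\<^sub>x) \<le> \<gamma> k" "\<gamma> k \<le> (1 + 2 / (real k + 2) / 4) * (1 / (2 * L\<^sub>x\<^sub>x))"
    using gamma[of k] by (simp_all add: lambda alpha)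
  have "L\<^sub>x\<^sub>x * (1 / (2 * L\<^sub>x\<^sub>x)) \<le> L\<^sub>x\<^sub>x * \<gamma> k" using g(1) Lip_pos by (intro mult_left_mono) auto
  then show "1 / 2 \<le> L\<^sub>x\<^sub>x * \<gamma> k" using Lip_pos by simp
  have "L\<^sub>x\<^sub>x * \<gamma> k \<le> L\<^sub>x\<^sub>x * ((1 + 2 / (real k + 2) / 4) * (1 / (2 * L\<^sub>x\<^sub>x)))"
    using g(2) Lip_pos by (intro mult_left_mono) auto
  also have "\<dots> = 1 / 2 + 1 / (4 * (real k + 2))" using Lip_pos by simp
  finally show "L\<^sub>x\<^sub>x * \<gamma> k \<le> 1 / 2 + 1 / (4 * (real k + 2))" .
qed

lemma gamma_le: "L\<^sub>x\<^sub>x * \<gamma> k \<le> 5 / 8"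
proof -
  have "1 / (4 * (real k + 2)) \<le> 1 / 8" by (simp add: field_simps)
  then show ?thesis using gamma_upper[of k] by linarith
qed

lemma gamma_pos: "\<gamma> k > 0"
proof -
  have "0 < L\<^sub>x\<^sub>x * \<gamma> k" using gamma_lower[of k] by linarith
  then show ?thesis using Lip_pos(1) by (simp add: zero_less_mult_iff)
qed

text \<open>\<open>C\<close> depends on the step size only to second order around \<open>1 / (2 L\<^sub>x\<^sub>x)\<close>; so its variation is
  of order \<open>1 / k\<^sup>2\<close>, which is summable.\<close>

lemma C_eq: "C k = 4 * L\<^sub>x\<^sub>x / (1 - (2 * (L\<^sub>x\<^sub>x * \<gamma> k) - 1)\<^sup>2)"
proof -
  have "1 - (2 * (L\<^sub>x\<^sub>x * \<gamma> k) - 1)\<^sup>2 = 4 * L\<^sub>x\<^sub>x * (\<gamma> k * (1 - L\<^sub>x\<^sub>x * \<gamma> k))"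
    by (simp add: power2_eq_square algebra_simps)
  then show ?thesis using Lip_pos by (simp add: C_def)
qed

lemma C_lower: "4 * L\<^sub>x\<^sub>x \<le> C k"
  and C_upper: "C k \<le> 4 * L\<^sub>x\<^sub>x / (1 - 1 / (4 * (real k + 2)\<^sup>2))"
proof -
  let ?t = "2 * (L\<^sub>x\<^sub>x * \<gamma> k) - 1"
  have t: "0 \<le> ?t" "?t \<le> 1 / (2 * (real k + 2))"
    using gamma_lower[of k] gamma_upper[of k] by (auto simp: field_simps)
  have "?t\<^sup>2 \<le> (1 / (2 * (real k + 2)))\<^sup>2" using t by (rule power_mono[rotated])
  also have eq: "\<dots> = 1 / (4 * (real k + 2)\<^sup>2)" by (simp only: power_divide power_mult_distrib) simp
  finally have sq: "?t\<^sup>2 \<le> 1 / (4 * (real k + 2)\<^sup>2)" .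
  have small: "1 / (4 * (real k + 2)\<^sup>2) < 1"
  proof -
    have "(2::real)\<^sup>2 \<le> (real k + 2)\<^sup>2" by (intro power_mono) auto
    then show ?thesis by (simp add: divide_less_eq)
  qed
  have pos: "0 < 1 - 1 / (4 * (real k + 2)\<^sup>2)" "0 < 1 - ?t\<^sup>2"
    using sq small by linarith+
  show "C k \<le> 4 * L\<^sub>x\<^sub>x / (1 - 1 / (4 * (real k + 2)\<^sup>2))"
    unfolding C_eq
    by (rule divide_left_mono[OF _ _ mult_pos_pos[OF pos(2) pos(1)]])
      (use sq Lip_pos in \<open>linarith+\<close>)
  have "4 * L\<^sub>x\<^sub>x / 1 \<le> 4 * L\<^sub>x\<^sub>x / (1 - ?t\<^sup>2)"
    by (rule divide_left_mono[OF _ _ mult_pos_pos[OF zero_less_one pos(2)]])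
      (use zero_le_power2[of ?t] Lip_pos in \<open>linarith+\<close>)
  then show "4 * L\<^sub>x\<^sub>x \<le> C k" unfolding C_eq by simp
qed

lemma C_pos: "C k > 0"
  using C_lower[of k] Lip_pos by linarith

lemma C_gamma_lower: "2 \<le> C j * \<gamma> k"
proof -
  have "2 \<le> 4 * (L\<^sub>x\<^sub>x * \<gamma> k)" using gamma_lower[of k] by linarith
  also have "\<dots> \<le> C j * \<gamma> k"
    using mult_right_mono[OF C_lower[of j], of "\<gamma> k"] gamma_pos[of k] by simp
  finally show ?thesis .
qed

lemma C_gamma_upper: "C (Suc j) * \<gamma> k \<le> 18 / 7"
proof -
  have "1 / (4 * (real (Suc j) + 2)\<^sup>2) \<le> 1 / (4 * 3\<^sup>2)"
    by (intro divide_left_mono mult_left_mono power_mono) auto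
  then have "4 * L\<^sub>x\<^sub>x / (1 - 1 / (4 * (real (Suc j) + 2)\<^sup>2)) \<le> 4 * L\<^sub>x\<^sub>x / (1 - 1 / (4 * 3\<^sup>2))"
    using Lip_pos by (intro divide_left_mono mult_pos_pos) auto
  with C_upper[of "Suc j"] have "C (Suc j) \<le> 144 / 35 * L\<^sub>x\<^sub>x" by simp
  then have "C (Suc j) * \<gamma> k \<le> 144 / 35 * (L\<^sub>x\<^sub>x * \<gamma> k)"
    using mult_right_mono[of "C (Suc j)" "144 / 35 * L\<^sub>x\<^sub>x" "\<gamma> k"] gamma_pos[of k] by simp
  with gamma_le[of k] show ?thesis by linarith
qed

lemma w_pos: "w k > 0" and w_ge_1: "w k \<ge> 1"
  by (simp_all add: w_def field_simps)

lemma w_Suc_upper: "w (Suc k) \<le> w k"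
  by (simp add: w_def field_simps)

lemma w_Suc_lower: "15 / 16 * w k \<le> w (Suc k)"
proof -
  have "15 * (real k + 4) * (real k + 4) \<le> 16 * ((real k + 5) * (real k + 3))"
    by (simp add: algebra_simps)
  then show ?thesis by (simp add: w_def field_simps)
qed

lemma w_C_Suc: "w (Suc k) * C (Suc k) \<le> w k * C k"
proof -
  define a where "a = real k + 3"
  have a: "a \<ge> 3" by (simp add: a_def)
  have a2: "a\<^sup>2 \<ge> 9" using power_mono[of 3 a 2] a by simp
  define q where "q = 1 - 1 / (4 * a\<^sup>2)"
  have q: "q > 0" using a2 by (simp add: q_def divide_less_eq)
  have "w (Suc k) = (a + 2) / (a + 1)" "w k = (a + 1) / a"
    by (simp_all add: w_def a_def algebra_simps)
  moreover have "(a + 2) / (a + 1) \<le> (a + 1) / a * q"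
  proof -
    have "q = (4 * a\<^sup>2 - 1) / (4 * a\<^sup>2)" using a by (simp add: q_def diff_divide_distrib)
    then have eq: "(a + 1) / a * q = ((a + 1) * (4 * a\<^sup>2 - 1)) / (a * (4 * a\<^sup>2))"
      by (simp only: times_divide_times_eq)
    have "0 \<le> (a - 1) * (3 * a + 1)" using a by simp
    then have "(a + 2) * (a * (4 * a\<^sup>2)) \<le> ((a + 1) * (4 * a\<^sup>2 - 1)) * (a + 1)"
      by (simp add: power2_eq_square algebra_simps)
    moreover have "0 < a * (4 * a\<^sup>2)" "0 < a + 1" using a by simp_all
    ultimately show ?thesis
      unfolding eq by (simp only: pos_le_divide_eq pos_divide_le_eq times_divide_eq_left)
  qed
  ultimately have wq: "w (Suc k) \<le> w k * q" by simp
  have Cq: "C (Suc k) \<le> 4 * L\<^sub>x\<^sub>x / q"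
    using C_upper[of "Suc k"] by (simp add: q_def a_def algebra_simps)
  have "w (Suc k) * C (Suc k) \<le> (w k * q) * (4 * L\<^sub>x\<^sub>x / q)"
    using wq Cq w_pos[of k] q C_pos[of "Suc k"] by (intro mult_mono) auto
  also have "\<dots> = w k * (4 * L\<^sub>x\<^sub>x)" using q by simp
  also have "\<dots> \<le> w k * C k" using C_lower[of k] w_pos[of k] by (intro mult_left_mono) auto
  finally show ?thesis .
qed

subsection \<open>Primal descent\<close>

text \<open>The primal gradient used in step \<open>k\<close>.\<close>

definition r :: "nat \<Rightarrow> 'a" where
  "r k = grad_x L (z (Suc k)) (y (Suc k))"

definition R :: "nat \<Rightarrow> real" where
  "R k = (norm (r k))\<^sup>2"

text \<open>The squared distance of the two primal sequences, scaled so that step \<open>k\<close> replaces it by at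
  most a convex combination of itself and \<open>R k\<close>.\<close>

definition N :: "nat \<Rightarrow> real" where
  "N k = 64 * L\<^sub>x\<^sub>x\<^sup>2 * (norm (xt k - x k))\<^sup>2"

text \<open>The decrease of \<open>L\<close> in the primal step, at the new dual iterate.\<close>

definition D :: "nat \<Rightarrow> real" where
  "D k = L (x k) (y (Suc k)) - L (x (Suc k)) (y (Suc k))"

lemma z_Suc: "z (Suc k) = (1 - \<alpha> k) *\<^sub>R xt k + \<alpha> k *\<^sub>R x k"
  and x_Suc: "x (Suc k) = x k - \<gamma> k *\<^sub>R r k"
  and xt_Suc: "xt (Suc k) = z (Suc k) - lam k *\<^sub>R r k"
  using run by (simp_all add: PDM_def Let_def r_def)

lemma y_Suc:
  "y (Suc k) = prox (\<sigma> k) h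
     (y k + \<sigma> k *\<^sub>R (A (z (Suc k)) + (C k / \<mu>) *\<^sub>R (A (x k) - A (x (k - 1)))))"
  using run by (simp add: PDM_def Let_def grad_y_eq C_def)

lemma R_nonneg: "R k \<ge> 0" and N_nonneg: "N k \<ge> 0"
  by (simp_all add: R_def N_def)

lemma alpha_bounds: "0 < \<alpha> k" "\<alpha> k \<le> 1"
  by (simp_all add: alpha field_simps)

text \<open>This says that \<open>N (k + 1) \<le> (1 - \<alpha>\<^sub>k) N k + \<alpha>\<^sub>k R k\<close>, by convexity of the squared norm. With
  \<open>W k = (k + 1) N k\<close> it reads \<open>W (k + 1) + N k \<le> W k + 2 R k\<close>, so that \<open>\<Sum>N k\<close> is at most
  \<open>W 0 + 2 \<Sum>R k\<close>.\<close>

lemma N_Suc: "(real k + 2) * N (Suc k) \<le> real k * N k + 2 * R k"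
proof -
  define e where "e = xt k - x k"
  \<comment> \<open>The condition on \<open>\<gamma> k\<close> is what bounds \<open>v\<close> by \<open>lam k / 4\<close> times \<open>r k\<close>.\<close>
  define v where "v = ((\<gamma> k - lam k) / \<alpha> k) *\<^sub>R r k"
  have "xt (Suc k) - x (Suc k) = (1 - \<alpha> k) *\<^sub>R e + (\<gamma> k - lam k) *\<^sub>R r k"
    by (simp add: xt_Suc x_Suc z_Suc e_def algebra_simps)
  also have "\<dots> = (1 - \<alpha> k) *\<^sub>R e + \<alpha> k *\<^sub>R v"
    using alpha_bounds[of k] by (simp add: v_def)
  finally have e': "xt (Suc k) - x (Suc k) = (1 - \<alpha> k) *\<^sub>R e + \<alpha> k *\<^sub>R v" .
  have g: "0 \<le> \<gamma> k - lam k" "\<gamma> k - lam k \<le> \<alpha> k * lam k / 4"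
    using gamma[of k] by (auto simp: algebra_simps)
  have "norm v = (\<gamma> k - lam k) / \<alpha> k * norm (r k)"
    using g alpha_bounds[of k] by (simp add: v_def)
  also have "\<dots> \<le> (1 / (8 * L\<^sub>x\<^sub>x)) * norm (r k)"
    using g alpha_bounds[of k] Lip_pos
    by (intro mult_right_mono) (simp_all add: lambda field_simps)
  finally have "(norm v)\<^sup>2 \<le> ((1 / (8 * L\<^sub>x\<^sub>x)) * norm (r k))\<^sup>2" by (rule power_mono) simp
  then have v: "64 * L\<^sub>x\<^sub>x\<^sup>2 * (norm v)\<^sup>2 \<le> R k"
    using Lip_pos by (simp add: R_def power_mult_distrib power_divide field_simps)
  have "norm (xt (Suc k) - x (Suc k)) \<le> (1 - \<alpha> k) * norm e + \<alpha> k * norm v"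
    unfolding e' using norm_triangle_ineq[of "(1 - \<alpha> k) *\<^sub>R e" "\<alpha> k *\<^sub>R v"] alpha_bounds[of k] by simp
  then have "(norm (xt (Suc k) - x (Suc k)))\<^sup>2 \<le> ((1 - \<alpha> k) * norm e + \<alpha> k * norm v)\<^sup>2"
    by (rule power_mono) simp
  also have "\<dots> = (1 - \<alpha> k) * (norm e)\<^sup>2 + \<alpha> k * (norm v)\<^sup>2
      - \<alpha> k * (1 - \<alpha> k) * (norm e - norm v)\<^sup>2"
    by (simp add: power2_eq_square algebra_simps)
  also have "\<dots> \<le> (1 - \<alpha> k) * (norm e)\<^sup>2 + \<alpha> k * (norm v)\<^sup>2"
    using alpha_bounds[of k] by simp
  finally have "64 * L\<^sub>x\<^sub>x\<^sup>2 * (norm (xt (Suc k) - x (Suc k)))\<^sup>2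
      \<le> 64 * L\<^sub>x\<^sub>x\<^sup>2 * ((1 - \<alpha> k) * (norm e)\<^sup>2 + \<alpha> k * (norm v)\<^sup>2)"
    by (rule mult_left_mono) simp
  then have "N (Suc k) \<le> (1 - \<alpha> k) * N k + \<alpha> k * (64 * L\<^sub>x\<^sub>x\<^sup>2 * (norm v)\<^sup>2)"
    by (simp add: N_def e_def algebra_simps)
  also have "\<dots> \<le> (1 - \<alpha> k) * N k + \<alpha> k * R k"
    using v alpha_bounds[of k] by simp
  finally have "(real k + 2) * N (Suc k) \<le> (real k + 2) * ((1 - \<alpha> k) * N k + \<alpha> k * R k)"
    by (rule mult_left_mono) simp
  also have "\<dots> = ((real k + 2) * (1 - \<alpha> k)) * N k + ((real k + 2) * \<alpha> k) * R k"
    by (simp add: algebra_simps)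
  also have a2: "(real k + 2) * \<alpha> k = 2" using nonzero_eq_divide_eq[of "real k + 2" "\<alpha> k" 2] by (simp add: alpha mult.commute)
  also have "(real k + 2) * (1 - \<alpha> k) = real k"
    using a2 by (simp add: right_diff_distrib)
  finally show ?thesis .
qed

lemma D_lower: "\<gamma> k * (5 / 8 * R k - N k / 16) \<le> D k"
proof -
  define g where "g = grad_x L (x k) (y (Suc k))"
  define e where "e = norm (xt k - x k)"
  have "norm (g - r k) \<le> L\<^sub>x\<^sub>x * norm (x k - z (Suc k))"
    using L_Lip[of "x k" "y (Suc k)" "z (Suc k)" "y (Suc k)"] by (simp add: g_def r_def)
  also have "x k - z (Suc k) = (1 - \<alpha> k) *\<^sub>R (x k - xt k)" by (simp add: z_Suc algebra_simps)
  also have "norm \<dots> \<le> 1 * e"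
    unfolding e_def norm_scaleR norm_minus_commute[of "xt k"]
    using alpha_bounds[of k] by (intro mult_right_mono) auto
  finally have gr: "norm (g - r k) \<le> L\<^sub>x\<^sub>x * e" using Lip_pos by simp
  have "- (g \<bullet> r k) = - R k - (g - r k) \<bullet> r k"
    by (simp add: R_def inner_diff_left dot_square_norm)
  also have "\<dots> \<le> - R k + norm (g - r k) * norm (r k)"
    using Cauchy_Schwarz_ineq2[of "g - r k" "r k"] by linarith
  also have "\<dots> \<le> - R k + (L\<^sub>x\<^sub>x * e) * norm (r k)"
    using gr by (intro add_left_mono mult_right_mono) auto
  also have "\<dots> \<le> - R k + (N k / 16 + R k / 16)"
  proof -
    have "0 \<le> (8 * (L\<^sub>x\<^sub>x * e) - norm (r k))\<^sup>2" by simp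
    then show ?thesis by (simp add: N_def R_def e_def power2_eq_square algebra_simps)
  qed
  finally have i: "- (g \<bullet> r k) \<le> - (15 / 16 * R k) + N k / 16" by simp
  have "L (x (Suc k)) (y (Suc k)) \<le> L (x k) (y (Suc k)) + \<gamma> k * (- (g \<bullet> r k))
      + \<gamma> k * ((L\<^sub>x\<^sub>x * \<gamma> k) / 2 * R k)"
    using descent_x[of "x k" "- (\<gamma> k *\<^sub>R r k)" "y (Suc k)"]
    by (simp add: x_Suc g_def R_def power_mult_distrib power2_eq_square algebra_simps)
  moreover have "\<gamma> k * (- (g \<bullet> r k)) \<le> \<gamma> k * (- (15 / 16 * R k) + N k / 16)"
    using i gamma_pos[of k] by (intro mult_left_mono) auto
  moreover have "\<gamma> k * ((L\<^sub>x\<^sub>x * \<gamma> k) / 2 * R k) \<le> \<gamma> k * (5 / 16 * R k)"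
    using gamma_le[of k] gamma_pos[of k] R_nonneg[of k]
    by (intro mult_left_mono mult_right_mono) auto
  ultimately show ?thesis by (simp add: D_def algebra_simps)
qed

lemma C_D_lower: "5 / 4 * R k - 9 / 56 * N k \<le> C (Suc j) * D k"
proof -
  have "C (Suc j) * (\<gamma> k * (5 / 8 * R k - N k / 16)) \<le> C (Suc j) * D k"
    using D_lower[of k] C_pos[of "Suc j"] by (intro mult_left_mono) auto
  moreover have "2 * (5 / 8 * R k) \<le> (C (Suc j) * \<gamma> k) * (5 / 8 * R k)"
    using C_gamma_lower[of "Suc j" k] R_nonneg[of k] by (intro mult_right_mono) auto
  moreover have "(C (Suc j) * \<gamma> k) * (N k / 16) \<le> 18 / 7 * (N k / 16)"
    using C_gamma_upper[of j k] N_nonneg[of k] by (intro mult_right_mono) auto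
  ultimately show ?thesis by (simp add: algebra_simps)
qed

lemma A_step: "norm (A (x (Suc k)) - A (x k)) \<le> L\<^sub>x\<^sub>y * \<gamma> k * norm (r k)"
proof -
  have "norm (x (Suc k) - x k) = \<gamma> k * norm (r k)"
    using gamma_pos[of k] by (simp add: x_Suc)
  then show ?thesis using A_lipschitz[of "x (Suc k)" "x k"] by (simp only: mult.assoc)
qed

lemma C_A_step: "C (Suc j) * norm (A (x (Suc k)) - A (x k)) \<le> 18 / 7 * L\<^sub>x\<^sub>y * norm (r k)"
proof -
  have "C (Suc j) * norm (A (x (Suc k)) - A (x k)) \<le> C (Suc j) * (L\<^sub>x\<^sub>y * \<gamma> k * norm (r k))"
    using A_step[of k] C_pos[of "Suc j"] by (intro mult_left_mono) auto
  also have "\<dots> = (C (Suc j) * \<gamma> k) * (L\<^sub>x\<^sub>y * norm (r k))" by simp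
  also have "\<dots> \<le> 18 / 7 * (L\<^sub>x\<^sub>y * norm (r k))"
    using C_gamma_upper[of j k] Lip_pos by (intro mult_right_mono) auto
  finally show ?thesis by simp
qed

text \<open>Young's inequality. The constant 16 has to stay below the factor 18 of the squared dual step
  length in the proximal inequality.\<close>

lemma C_A_step_inner:
  "C (Suc j) * ((A (x (Suc k)) - A (x k)) \<bullet> v) \<le> 16 * L\<^sub>x\<^sub>y\<^sup>2 * (norm v)\<^sup>2 + 81 / 784 * R k"
proof -
  have "C (Suc j) * ((A (x (Suc k)) - A (x k)) \<bullet> v)
      \<le> C (Suc j) * (norm (A (x (Suc k)) - A (x k)) * norm v)"
    using norm_cauchy_schwarz[of "A (x (Suc k)) - A (x k)" v] C_pos[of "Suc j"] by (intro mult_left_mono) auto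
  also have "\<dots> = (C (Suc j) * norm (A (x (Suc k)) - A (x k))) * norm v" by simp
  also have "\<dots> \<le> (18 / 7 * L\<^sub>x\<^sub>y * norm (r k)) * norm v"
    using C_A_step[of j k] by (intro mult_right_mono) auto
  also have "\<dots> \<le> 16 * L\<^sub>x\<^sub>y\<^sup>2 * (norm v)\<^sup>2 + 81 / 784 * R k"
  proof -
    have "0 \<le> (4 * L\<^sub>x\<^sub>y * norm v - 9 / 28 * norm (r k))\<^sup>2" by simp
    then show ?thesis by (simp add: R_def power2_eq_square algebra_simps)
  qed
  finally show ?thesis .
qed

subsection \<open>Dual step\<close>

text \<open>The squared dual distance to the saddle point, the excess of \<open>L \<sqdot> ys\<close> over its minimum, and the
  length of the dual step.\<close>

definition Y :: "nat \<Rightarrow> real" where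
  "Y k = (norm (y k - ys))\<^sup>2"

definition E :: "nat \<Rightarrow> real" where
  "E k = L (x k) ys - L xs ys"

definition d :: "nat \<Rightarrow> real" where
  "d k = norm (y (Suc k) - y k)"

lemma Y_nonneg: "Y k \<ge> 0" and E_nonneg: "E k \<ge> 0"
  using saddle_x by (simp_all add: Y_def E_def)

text \<open>The subgradient of \<open>h\<close> at the new dual iterate that the proximal step provides.\<close>

definition s :: "nat \<Rightarrow> 'b" where
  "s k = (1 / \<sigma> k) *\<^sub>R (y k - y (Suc k)) + A (z (Suc k))
     + (C k / \<mu>) *\<^sub>R (A (x k) - A (x (k - 1)))"

lemma s_subdifferential: "s k \<in> subdifferential h (y (Suc k))"
proof -
  let ?q = "A (z (Suc k)) + (C k / \<mu>) *\<^sub>R (A (x k) - A (x (k - 1)))"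
  have "(1 / \<sigma> k) *\<^sub>R (y k + \<sigma> k *\<^sub>R ?q - y (Suc k)) \<in> subdifferential h (y (Suc k))"
    unfolding y_Suc by (rule prox_subgradient[OF h_convex h_prox sigma_pos])
  also have "(1 / \<sigma> k) *\<^sub>R (y k + \<sigma> k *\<^sub>R ?q - y (Suc k)) = (1 / \<sigma> k) *\<^sub>R (y k - y (Suc k)) + (1 / \<sigma> k) *\<^sub>R (\<sigma> k *\<^sub>R ?q)"
    by (simp add: scaleR_diff_right scaleR_add_right)
  also have "\<dots> = s k"
    using sigma_pos[of k] by (simp add: s_def)
  finally show ?thesis .
qed

text \<open>The subgradient inequality at \<open>ys\<close>, multiplied by \<open>\<mu>\<close>; note that \<open>\<mu> / (2 \<sigma>\<^sub>k) = 18 L\<^sub>x\<^sub>y\<^sup>2\<close>.\<close>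

lemma dual_step:
  "18 * L\<^sub>x\<^sub>y\<^sup>2 * (Y (Suc k) + (d k)\<^sup>2 - Y k)
     \<le> R k / 2 + C k * ((A (x k) - A (x (k - 1))) \<bullet> (y (Suc k) - ys))"
proof -
  let ?y = "y (Suc k)" and ?a = "A (x k) - A (x (k - 1))"
  let ?h = "\<lambda>v. real_of_ereal (h v)"
  have hy: "\<bar>h ?y\<bar> \<noteq> \<infinity>" and "h ?y + ereal (s k \<bullet> (ys - ?y)) \<le> h ys"
    using s_subdifferential[of k] by (auto simp: subdifferential_def)
  then have "?h ?y + s k \<bullet> (ys - ?y) \<le> ?h ys"
    using h_ys by (cases "h ?y"; cases "h ys") auto
  then have 1: "\<mu> * (s k \<bullet> (ys - ?y)) \<le> \<mu> * (?h ys - ?h ?y)"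
    using mu_pos by (intro mult_left_mono) auto
  have 2: "\<mu> * ((L (z (Suc k)) ?y - ?h ?y) - (L (z (Suc k)) ys - ?h ys)) \<le> R k / 2"
    using PL_saddle_gap[OF hy, of "z (Suc k)"] by (simp add: R_def r_def)
  have 3: "L (z (Suc k)) ?y - L (z (Suc k)) ys = - (A (z (Suc k)) \<bullet> (ys - ?y))"
    by (simp add: L_diff_y inner_diff_right)
  have "Y k = (norm ((y k - ?y) + (-1) *\<^sub>R (ys - ?y)))\<^sup>2" by (simp add: Y_def)
  then have 4: "2 * ((y k - ?y) \<bullet> (ys - ?y)) = (d k)\<^sup>2 + Y (Suc k) - Y k"
    unfolding norm_add_scaleR_sq
    by (simp add: Y_def d_def norm_minus_commute)
  have "\<mu> * (s k \<bullet> (ys - ?y)) = 18 * L\<^sub>x\<^sub>y\<^sup>2 * (2 * ((y k - ?y) \<bullet> (ys - ?y)))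
      + \<mu> * (A (z (Suc k)) \<bullet> (ys - ?y)) + C k * (?a \<bullet> (ys - ?y))"
    unfolding s_def inner_add_left inner_scaleR_left distrib_left
    using mu_pos by (simp add: sigma)
  also have "?a \<bullet> (ys - ?y) = - (?a \<bullet> (?y - ys))" by (simp add: inner_diff_right)
  finally have 5: "\<mu> * (s k \<bullet> (ys - ?y)) = 18 * L\<^sub>x\<^sub>y\<^sup>2 * ((d k)\<^sup>2 + Y (Suc k) - Y k)
      + \<mu> * (A (z (Suc k)) \<bullet> (ys - ?y)) - C k * (?a \<bullet> (?y - ys))"
    unfolding 4 by simp
  have "\<mu> * ((L (z (Suc k)) ?y - ?h ?y) - (L (z (Suc k)) ys - ?h ys))
      = - (\<mu> * (A (z (Suc k)) \<bullet> (ys - ?y))) + \<mu> * (?h ys - ?h ?y)"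
    proof -
    have "\<mu> * ((l1 - h1) - (l2 - h2)) = \<mu> * (l1 - l2) + \<mu> * (h2 - h1)" for l1 l2 h1 h2
      by (simp add: algebra_simps)
    then show ?thesis by (simp add: 3)
  qed
  with 1 2 5 show ?thesis by (simp add: add.commute)
qed

lemma A_step_inner_saddle:
  "(A (x (Suc k)) - A (x k)) \<bullet> (y (Suc k) - ys) = - D k - E (Suc k) + E k"
  using L_diff_y[of "x (Suc k)" "y (Suc k)" ys] L_diff_y[of "x k" "y (Suc k)" ys]
  by (simp add: D_def E_def inner_diff_left)

subsection \<open>The Lyapunov function\<close>

text \<open>The energy \<open>B\<close> pairs the dual iterate \<open>k + 1\<close> with the primal iterate \<open>k\<close>. Its last term pays
  for the errors \<open>N k\<close>. In the Lyapunov function \<open>P\<close>, the subtracted term is the primal gap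
  of step \<open>k\<close>, which is paid for by the primal decrease of the next step.\<close>

definition B :: "nat \<Rightarrow> real" where
  "B k = 18 * L\<^sub>x\<^sub>y\<^sup>2 * Y (Suc k) + C k * E k + 9 / 56 * (real k + 1) * N k"

definition P :: "nat \<Rightarrow> real" where
  "P k = w k * (B k - R k / 2)"

text \<open>The next dual step produces the energy \<open>B k\<close> with \<open>C (k + 1)\<close> in place of \<open>C k\<close>; the weights
  make up for the difference.\<close>

lemma w_B_next:
  "w (Suc k) * (18 * L\<^sub>x\<^sub>y\<^sup>2 * Y (Suc k) + C (Suc k) * E k + 9 / 56 * (real k + 1) * N k)
     \<le> w k * B k"
proof -
  let ?q = "18 * L\<^sub>x\<^sub>y\<^sup>2 * Y (Suc k) + 9 / 56 * (real k + 1) * N k"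
  have "w (Suc k) * ?q \<le> w k * ?q"
    using w_Suc_upper[of k] Y_nonneg[of "Suc k"] N_nonneg[of k] by (intro mult_right_mono) auto
  moreover have "(w (Suc k) * C (Suc k)) * E k \<le> (w k * C k) * E k"
    using w_C_Suc[of k] E_nonneg[of k] by (intro mult_right_mono)
  ultimately show ?thesis by (simp add: B_def algebra_simps)
qed

lemma B_Suc:
  "B (Suc k) + 2 * L\<^sub>x\<^sub>y\<^sup>2 * (d (Suc k))\<^sup>2 + 4 / 5 * R k
     \<le> 18 * L\<^sub>x\<^sub>y\<^sup>2 * Y (Suc k) + C (Suc k) * E k + 9 / 56 * (real k + 1) * N k + R (Suc k) / 2"
proof -
  let ?a = "A (x (Suc k)) - A (x k)"
  define i where "i = ?a \<bullet> (y (Suc (Suc k)) - y (Suc k))"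
  have "?a \<bullet> (y (Suc (Suc k)) - ys) = ?a \<bullet> (y (Suc k) - ys) + i"
    by (simp add: i_def inner_diff_right)
  then have "?a \<bullet> (y (Suc (Suc k)) - ys) = - D k - E (Suc k) + E k + i"
    by (simp only: A_step_inner_saddle)
  then have "18 * L\<^sub>x\<^sub>y\<^sup>2 * (Y (Suc (Suc k)) + (d (Suc k))\<^sup>2 - Y (Suc k))
      \<le> R (Suc k) / 2 + C (Suc k) * (- D k - E (Suc k) + E k + i)"
    using dual_step[of "Suc k"] by simp
  moreover have "C (Suc k) * i \<le> 16 * L\<^sub>x\<^sub>y\<^sup>2 * (d (Suc k))\<^sup>2 + 81 / 784 * R k"
    unfolding d_def i_def by (rule C_A_step_inner)
  moreover have "C (Suc k) * (- D k - E (Suc k) + E k + i)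
      = - (C (Suc k) * D k) - C (Suc k) * E (Suc k) + C (Suc k) * E k + C (Suc k) * i"
    by (simp add: algebra_simps)
  moreover have "B (Suc k) = 18 * L\<^sub>x\<^sub>y\<^sup>2 * Y (Suc (Suc k)) + C (Suc k) * E (Suc k)
      + 9 / 56 * ((real k + 2) * N (Suc k))"
    by (simp add: B_def algebra_simps)
  moreover have "9 / 56 * (real k + 1) * N k = 9 / 56 * (real k * N k) + 9 / 56 * N k"
    by (simp add: algebra_simps)
  moreover have "18 * L\<^sub>x\<^sub>y\<^sup>2 * (Y (Suc (Suc k)) + (d (Suc k))\<^sup>2 - Y (Suc k))
      = 18 * L\<^sub>x\<^sub>y\<^sup>2 * Y (Suc (Suc k)) + 16 * L\<^sub>x\<^sub>y\<^sup>2 * (d (Suc k))\<^sup>2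
        + 2 * L\<^sub>x\<^sub>y\<^sup>2 * (d (Suc k))\<^sup>2 - 18 * L\<^sub>x\<^sub>y\<^sup>2 * Y (Suc k)"
    by (simp add: algebra_simps)
  ultimately show ?thesis
    using C_D_lower[of k k] N_Suc[of k] R_nonneg[of k] by linarith
qed

text \<open>This makes \<open>P\<close> nonnegative: the decrease \<open>D k\<close> controls \<open>R k\<close>, and it is itself at most
  \<open>E k\<close> plus an inner product with \<open>y\<^sub>k\<^sub>+\<^sub>1 - ys\<close>.\<close>

lemma R_le_B: "R k \<le> B k"
proof -
  let ?a = "A (x (Suc k)) - A (x k)"
  have "?a \<bullet> (ys - y (Suc k)) = - (?a \<bullet> (y (Suc k) - ys))" by (simp add: inner_diff_right)
  then have "?a \<bullet> (ys - y (Suc k)) = D k + E (Suc k) - E k"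
    by (simp add: A_step_inner_saddle)
  then have "C (Suc k) * (D k + E (Suc k) - E k) \<le> 16 * L\<^sub>x\<^sub>y\<^sup>2 * Y (Suc k) + 81 / 784 * R k"
    using C_A_step_inner[of k k "ys - y (Suc k)"] by (simp add: Y_def norm_minus_commute)
  moreover have "0 \<le> C (Suc k) * E (Suc k)" using C_pos[of "Suc k"] E_nonneg by simp
  ultimately have "C (Suc k) * D k \<le> C (Suc k) * E k + 16 * L\<^sub>x\<^sub>y\<^sup>2 * Y (Suc k) + 81 / 784 * R k"
    by (simp add: algebra_simps)
  then have "16 / 15 * R k \<le> 16 * L\<^sub>x\<^sub>y\<^sup>2 * Y (Suc k) + C (Suc k) * E k + 9 / 56 * N k"
    using C_D_lower[of k k] R_nonneg[of k] by linarith
  also have "\<dots> \<le> 18 * L\<^sub>x\<^sub>y\<^sup>2 * Y (Suc k) + C (Suc k) * E k + 9 / 56 * (real k + 1) * N k"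
    using Y_nonneg[of "Suc k"] N_nonneg[of k]
    by (intro add_mono order_refl mult_right_mono) auto
  finally have "w (Suc k) * (16 / 15 * R k) \<le> w k * B k"
    using w_B_next[of k] w_pos[of "Suc k"] by (meson mult_left_mono less_imp_le order_trans)
  moreover have "w k * R k \<le> w (Suc k) * (16 / 15 * R k)"
    using mult_right_mono[OF w_Suc_lower[of k] R_nonneg[of k]] by simp
  ultimately have "w k * R k \<le> w k * B k" by linarith
  then show ?thesis using w_pos[of k] by simp
qed

lemma P_nonneg: "P k \<ge> 0"
  using R_le_B[of k] R_nonneg[of k] w_pos[of k] by (simp add: P_def)

text \<open>The guaranteed decrease of \<open>P\<close> in step \<open>k\<close>.\<close>

definition G :: "nat \<Rightarrow> real" where
  "G k = 2 * L\<^sub>x\<^sub>y\<^sup>2 * (d (Suc k))\<^sup>2 + R k / 4"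

lemma G_nonneg: "G k \<ge> 0"
  using R_nonneg[of k] by (simp add: G_def)

lemma P_Suc: "P (Suc k) + G k \<le> P k"
proof -
  let ?d = "2 * L\<^sub>x\<^sub>y\<^sup>2 * (d (Suc k))\<^sup>2"
  have "w (Suc k) * (B (Suc k) + ?d + 4 / 5 * R k) \<le> w (Suc k) *
     (18 * L\<^sub>x\<^sub>y\<^sup>2 * Y (Suc k) + C (Suc k) * E k + 9 / 56 * (real k + 1) * N k + R (Suc k) / 2)"
    using B_Suc[of k] w_pos[of "Suc k"] by (intro mult_left_mono) auto
  also have "\<dots> \<le> w k * B k + w (Suc k) * (R (Suc k) / 2)"
    using w_B_next[of k] by (simp add: algebra_simps)
  finally have "P (Suc k) + w (Suc k) * ?d + 4 / 5 * (w (Suc k) * R k) \<le> P k + w k * R k / 2"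
    by (simp add: P_def algebra_simps)
  moreover have "1 * ?d \<le> w (Suc k) * ?d"
    using w_ge_1[of "Suc k"] by (intro mult_right_mono) auto
  moreover have "15 / 16 * w k * R k \<le> w (Suc k) * R k"
    using w_Suc_lower[of k] R_nonneg[of k] by (intro mult_right_mono)
  moreover have "1 * R k \<le> w k * R k" using w_ge_1[of k] R_nonneg[of k] by (intro mult_right_mono)
  ultimately show ?thesis by (simp add: G_def)
qed

lemma sum_G_le: "(\<Sum>k<n. G k) \<le> P 0"
proof -
  have "(\<Sum>k<n. G k) + P n \<le> P 0"
  proof (induction n)
    case (Suc n)
    with P_Suc[of n] show ?case by simp
  qed simp
  then show ?thesis using P_nonneg[of n] by linarith
qed

subsection \<open>Stationarity\<close>

text \<open>Two consecutive steps enter because the extrapolation in step \<open>k + 1\<close> contains \<open>r k\<close>. The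
  radius is \<open>18 + 18/7\<close>, rounded up to 21, times \<open>L\<^sub>x\<^sub>y / \<mu>\<close>.\<close>

lemma stationary_step:
  assumes "G k \<le> \<epsilon>\<^sup>2 / 4" "G (Suc k) \<le> \<epsilon>\<^sup>2 / 4" "\<epsilon> > 0"
  shows "eps_stationary L h (21 * L\<^sub>x\<^sub>y / \<mu>) \<epsilon> (z (Suc (Suc k))) (y (Suc (Suc k)))"
proof -
  have R: "norm (r j) \<le> \<epsilon>" if "G j \<le> \<epsilon>\<^sup>2 / 4" for j
  proof -
    have "0 \<le> 2 * L\<^sub>x\<^sub>y\<^sup>2 * (d (Suc j))\<^sup>2" by simp
    with that[unfolded G_def R_def] have "(norm (r j))\<^sup>2 \<le> \<epsilon>\<^sup>2" by linarith
    then show ?thesis using assms(3) by (simp add: power2_le_iff_abs_le)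
  qed
  have "(2 * L\<^sub>x\<^sub>y * d (Suc k))\<^sup>2 \<le> \<epsilon>\<^sup>2"
  proof -
    have "(2 * L\<^sub>x\<^sub>y * d (Suc k))\<^sup>2 = 4 * (L\<^sub>x\<^sub>y\<^sup>2 * (d (Suc k))\<^sup>2)"
      by (simp add: power_mult_distrib)
    moreover have "0 \<le> L\<^sub>x\<^sub>y\<^sup>2 * (d (Suc k))\<^sup>2" by simp
    ultimately show ?thesis using assms(1)[unfolded G_def] R_nonneg[of k] by linarith
  qed
  then have dk: "2 * L\<^sub>x\<^sub>y * d (Suc k) \<le> \<epsilon>"
    by (rule power2_le_imp_le) (use assms in simp)
  let ?b = "A (z (Suc (Suc k))) - s (Suc k)"
  have "?b = (1 / \<sigma> (Suc k)) *\<^sub>R (y (Suc (Suc k)) - y (Suc k))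
      - (C (Suc k) / \<mu>) *\<^sub>R (A (x (Suc k)) - A (x k))"
    by (simp add: s_def algebra_simps)
  also have "norm \<dots> \<le> norm ((1 / \<sigma> (Suc k)) *\<^sub>R (y (Suc (Suc k)) - y (Suc k)))
      + norm ((C (Suc k) / \<mu>) *\<^sub>R (A (x (Suc k)) - A (x k)))"
    by (rule norm_triangle_ineq4)
  also have "\<dots> = 36 * L\<^sub>x\<^sub>y\<^sup>2 / \<mu> * d (Suc k) + (C (Suc k) * norm (A (x (Suc k)) - A (x k))) / \<mu>"
    using mu_pos C_pos[of "Suc k"] Lip_pos by (simp add: d_def sigma)
  also have "\<dots> \<le> 18 * L\<^sub>x\<^sub>y / \<mu> * \<epsilon> + 3 * L\<^sub>x\<^sub>y * \<epsilon> / \<mu>"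
  proof (rule add_mono)
    have "18 * L\<^sub>x\<^sub>y / \<mu> * (2 * L\<^sub>x\<^sub>y * d (Suc k)) \<le> 18 * L\<^sub>x\<^sub>y / \<mu> * \<epsilon>"
      using dk mu_pos Lip_pos by (intro mult_left_mono) auto
    then show "36 * L\<^sub>x\<^sub>y\<^sup>2 / \<mu> * d (Suc k) \<le> 18 * L\<^sub>x\<^sub>y / \<mu> * \<epsilon>"
      by (simp add: power2_eq_square)
    have "C (Suc k) * norm (A (x (Suc k)) - A (x k)) \<le> 18 / 7 * L\<^sub>x\<^sub>y * norm (r k)"
      by (rule C_A_step)
    also have "\<dots> \<le> 3 * L\<^sub>x\<^sub>y * \<epsilon>"
      using R[OF assms(1)] Lip_pos by (intro mult_mono) auto
    finally show "(C (Suc k) * norm (A (x (Suc k)) - A (x k))) / \<mu> \<le> 3 * L\<^sub>x\<^sub>y * \<epsilon> / \<mu>"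
      using mu_pos by (intro divide_right_mono) auto
  qed
  also have "\<dots> = 21 * L\<^sub>x\<^sub>y / \<mu> * \<epsilon>" by (simp add: field_simps)
  finally have "?b \<in> cball 0 (21 * L\<^sub>x\<^sub>y / \<mu> * \<epsilon>)" by simp
  with s_subdifferential[of "Suc k"]
  have "s (Suc k) + ?b \<in> subdifferential h (y (Suc (Suc k))) + cball 0 (21 * L\<^sub>x\<^sub>y / \<mu> * \<epsilon>)"
    by (rule set_plus_intro)
  then show ?thesis
    using R[OF assms(2)] by (simp add: eps_stationary_def grad_y_eq r_def)
qed

text \<open>The sum of \<open>G k + G (k + 1)\<close> over \<open>k < n\<close> is at most \<open>2 P 0\<close>, so that for large \<open>n\<close> one of the
  summands is at most \<open>\<epsilon>\<^sup>2 / 4\<close>.\<close>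

theorem stationary_within:
  assumes "\<epsilon> > 0" "8 * P 0 / \<epsilon>\<^sup>2 < real n"
  shows "\<exists>k\<in>{0..n + 1}. eps_stationary L h (21 * L\<^sub>x\<^sub>y / \<mu>) \<epsilon> (z k) (y k)"
proof -
  have "\<exists>k<n. G k + G (Suc k) \<le> \<epsilon>\<^sup>2 / 4"
  proof (rule ccontr)
    assume "\<not> ?thesis"
    then have "\<epsilon>\<^sup>2 / 4 \<le> G k + G (Suc k)" if "k \<in> {..<n}" for k
      using that by (meson lessThan_iff less_imp_le not_le)
    from sum_bounded_below[of "{..<n}" "\<epsilon>\<^sup>2 / 4" "\<lambda>k. G k + G (Suc k)", OF this]
    have "real n * (\<epsilon>\<^sup>2 / 4) \<le> (\<Sum>k<n. G k) + (\<Sum>k<n. G (Suc k))"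
      by (simp add: sum.distrib)
    also have "(\<Sum>k<n. G (Suc k)) \<le> (\<Sum>k<Suc n. G k)"
      unfolding sum.lessThan_Suc_shift[of G n] using G_nonneg[of 0] by simp
    also have "(\<Sum>k<n. G k) + (\<Sum>k<Suc n. G k) \<le> P 0 + P 0"
      by (intro add_mono sum_G_le)
    finally show False using assms by (simp add: field_simps)
  qed
  then obtain k where k: "k < n" "G k + G (Suc k) \<le> \<epsilon>\<^sup>2 / 4" by blast
  have "eps_stationary L h (21 * L\<^sub>x\<^sub>y / \<mu>) \<epsilon> (z (Suc (Suc k))) (y (Suc (Suc k)))"
    using k(2) G_nonneg[of k] G_nonneg[of "Suc k"] assms(1) by (intro stationary_step) auto
  then show ?thesis using k(1) by (intro bexI[of _ "Suc (Suc k)"]) auto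
qed

text \<open>Each iteration makes four gradient evaluations, and the number of iterations is at most
  \<open>8 P 0 / \<epsilon>\<^sup>2 + 2\<close>.\<close>

theorem complexity:
  "\<exists>r>0. \<exists>T :: real \<Rightarrow> nat.
     (\<forall>\<epsilon>>0. \<exists>k\<in>{0..T \<epsilon>}. eps_stationary L h r \<epsilon> (z k) (y k)) \<and>
     (\<lambda>\<epsilon>. real (gradient_evaluations x y z (T \<epsilon>))) \<in> O[at_right 0](\<lambda>\<epsilon>. 1 / \<epsilon>\<^sup>2)"
proof (intro exI conjI allI impI)
  define n :: "real \<Rightarrow> nat" where "n \<epsilon> = nat \<lfloor>8 * P 0 / \<epsilon>\<^sup>2\<rfloor> + 1" for \<epsilon>
  have n_lower: "8 * P 0 / \<epsilon>\<^sup>2 < real (n \<epsilon>)" for \<epsilon>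
    unfolding n_def by linarith
  have n_upper: "real (n \<epsilon>) \<le> 8 * P 0 / \<epsilon>\<^sup>2 + 1" for \<epsilon>
    using P_nonneg[of 0] by (simp add: n_def)
  show "21 * L\<^sub>x\<^sub>y / \<mu> > 0" using mu_pos Lip_pos by simp
  show "\<exists>k\<in>{0..n \<epsilon> + 1}. eps_stationary L h (21 * L\<^sub>x\<^sub>y / \<mu>) \<epsilon> (z k) (y k)" if "\<epsilon> > 0" for \<epsilon>
    using that n_lower by (rule stationary_within)
  have ge: "gradient_evaluations x y z T = 4 * T" for T
    by (simp add: gradient_evaluations_def PDM_queries_def)
  show "(\<lambda>\<epsilon>. real (gradient_evaluations x y z (n \<epsilon> + 1))) \<in> O[at_right 0](\<lambda>\<epsilon>. 1 / \<epsilon>\<^sup>2)"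
  proof (rule bigoI)
    show "\<forall>\<^sub>F \<epsilon> in at_right 0. norm (real (gradient_evaluations x y z (n \<epsilon> + 1)))
        \<le> (32 * P 0 + 8) * norm (1 / \<epsilon>\<^sup>2)"
    proof (rule eventually_at_rightI[of 0 1])
      fix \<epsilon> :: real assume "\<epsilon> \<in> {0<..<1}"
      then have "1 \<le> 1 / \<epsilon>\<^sup>2" by (simp add: power_le_one)
      with n_upper[of \<epsilon>] show "norm (real (gradient_evaluations x y z (n \<epsilon> + 1)))
        \<le> (32 * P 0 + 8) * norm (1 / \<epsilon>\<^sup>2)"
        by (simp add: ge algebra_simps add_divide_distrib)
    qed simp
  qed
qed

end

theorem theorem2:
  fixes L :: "real^'n \<Rightarrow> real^'m \<Rightarrow> real"
    and h :: "real^'m \<Rightarrow> ereal"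
    and \<mu> L\<^sub>x\<^sub>x L\<^sub>x\<^sub>y :: real
    and \<alpha> \<sigma> \<gamma> lam :: "nat \<Rightarrow> real"
    and x xt z :: "nat \<Rightarrow> real^'n"
    and y :: "nat \<Rightarrow> real^'m"
  assumes solvable: "minmax_solutions L h \<noteq> {}"
    and h_convex: "convex_ext h"
    and h_prox: "prox_well_defined h"
    and L_C1: "continuously_differentiable (\<lambda>(x, y). L x y)"
    and L_concave: "\<And>x. concave_on UNIV (L x)"
    and mu_pos: "\<mu> > 0"
    and L_PL: "one_sided_PL L \<mu>"
    and Lip_pos: "L\<^sub>x\<^sub>x > 0" "L\<^sub>x\<^sub>y > 0"
    and L_Lip: "\<And>x x' y y'. norm (grad_x L x y - grad_x L x' y')
                  \<le> L\<^sub>x\<^sub>x * norm (x - x') + L\<^sub>x\<^sub>y * norm (y - y')"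
    and L_affine: "\<And>x. affine_map (L x)"
    and sigma: "\<And>k. \<sigma> k = \<mu> / (36 * L\<^sub>x\<^sub>y\<^sup>2)"
    and alpha: "\<And>k. \<alpha> k = 2 / (real k + 2)"
    and lambda: "\<And>k. lam k = 1 / (2 * L\<^sub>x\<^sub>x)"
    and gamma: "\<And>k. \<gamma> k \<in> {lam k .. (1 + \<alpha> k / 4) * lam k}"
    and run: "PDM L h L\<^sub>x\<^sub>x \<mu> \<alpha> \<sigma> \<gamma> lam x xt y z"
  shows "\<exists>r>0. \<exists>T :: real \<Rightarrow> nat.
           (\<forall>\<epsilon>>0. \<exists>k\<in>{0..T \<epsilon>}. eps_stationary L h r \<epsilon> (z k) (y k)) \<and>
           (\<lambda>\<epsilon>. real (gradient_evaluations x y z (T \<epsilon>))) \<in> O[at_right 0](\<lambda>\<epsilon>. 1 / \<epsilon>\<^sup>2)"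
proof -
  interpret pdm_run L h \<mu> L\<^sub>x\<^sub>x L\<^sub>x\<^sub>y \<alpha> \<sigma> \<gamma> lam x xt z y
    by (unfold_locales; fact)
  show ?thesis by (rule complexity)
qed

end
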